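(* Let $\theta_0 \in (0,1)$ (i.e. $\theta_0$ lies in the interior of the parameter space $[0,1]$) and let $X_1,\dots,X_n$ be i.i.d. Bernoulli$(\theta_0)$ random variables, with sample proportion $\bar\theta = \frac1n\sum_{i=1}^n \mathbb{1}(X_i=1)$. Suppose the released differentially private statistic is produced by the additive mechanism $$\hat\pi = \bar\theta + Y,\qquad Y = \frac{\Delta_{\bar\theta}}{\epsilon} Z,\quad \Delta_{\bar\theta}=\frac1n,$$ where $\epsilon>0$ is a fixed privacy budget and $Z$ is a zero-mean, unit-variance random variable with known distribution, independent of the data. Let $\hat\theta$ be the Fiducial Matching (FIMA) random variable defined, conditionally on $\hat\pi$, as follows: draw an independent copy $Y^*$ of $Y$ and set $\tilde\theta^* = \hat\pi - Y^*$; if $\tilde\theta^*>1$ set $\hat\theta = 1-\delta$; if $\tilde\theta^*<0$ set $\hat\theta=\delta$; otherwise draw $U_1^*,\dots,U_n^*$ i.i.d. $U(0,1)$ with order statistics $U^*_{[1]}\le\dots\le U^*_{[n]}$ (with the conventions $U^*_{[0]}:=\delta$ and $U^*_{[n+1]}:=1-\delta$), let $a = U^*_{[\lfloor n\tilde\theta^*\rfloor]}$, $b=U^*_{[\lfloor n\tilde\theta^*+1\rfloor]}$, and set $\hat\theta = a + D(b-a)$, where $D$ is an independent random variable supported on $[0,1]$; here $0<\delta\ll1$ is a fixed small constant. For $\alpha\in(0,1)$ define the conditional quantile $$\hat\theta_\alpha := \inf\{v\in\mathbb{R} : \mathbb{P}(\hat\theta\le v \mid \hat\pi)\ge \alpha\}.$$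 Then, as $n\to\infty$, $$\mathbb{P}(\theta_0 \le \hat\theta_\alpha) = \alpha + o_p(1).$$
   Context: $\hat\theta$ is a (randomized) solution of the matching problem $\hat\theta \in \mathrm{argzero}_{\theta\in[0,1]}[\hat\pi - \hat\pi^*(\theta)]$, where $\hat\pi^*(\theta)=\bar\theta^*(\theta)+Y^*$ and $\bar\theta^*(\theta)=\frac1n\sum_{i=1}^n\mathbb{1}(U_i^*\le\theta)$ is the empirical CDF of the simulated uniforms; the value is drawn from the interval $F_{U^*}^{-1}(\tilde\theta^* )$ of solutions. Typical choices: $Z\sim\mathrm{Laplace}(0,1)$ (pure $\epsilon$-DP) or $Z\sim N(0,1)$. *)

theory Defs
  imports "HOL-Probability.Probability"
begin

definition order_stat :: "nat \<Rightarrow> (nat \<Rightarrow> real) \<Rightarrow> nat \<Rightarrow> real" where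
  "order_stat n u k = sort (map u [0..<n]) ! (k - 1)"

definition order_stat_ext :: "nat \<Rightarrow> real \<Rightarrow> (nat \<Rightarrow> real) \<Rightarrow> nat \<Rightarrow> real" where
  "order_stat_ext n \<delta> u k =
     (if k = 0 then \<delta> else if k = n + 1 then 1 - \<delta> else order_stat n u k)"

text \<open>The FIMA value theta-hat as a function of the observed pi-hat = p and of the
  auxiliary randomness (Z*, U*_1..U*_n, D); Y* = (1/n)/eps * Z*.\<close>
definition fima_value :: "nat \<Rightarrow> real \<Rightarrow> real \<Rightarrow> real \<Rightarrow> real \<times> (nat \<Rightarrow> real) \<times> real \<Rightarrow> real" where
  "fima_value n \<epsilon> \<delta> p \<omega> =
     (case \<omega> of (z, u, d) \<Rightarrow>
       (let t = p - (1 / real n) / \<epsilon> * z in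
        if t > 1 then 1 - \<delta>
        else if t < 0 then \<delta>
        else (let a = order_stat_ext n \<delta> u (nat \<lfloor>real n * t\<rfloor>);
                  b = order_stat_ext n \<delta> u (nat \<lfloor>real n * t + 1\<rfloor>)
              in a + d * (b - a))))"

text \<open>Conditional law of theta-hat given pi-hat = p: Z* ~ Zdist, U* iid U(0,1), D ~ Ddist,
  all independent.\<close>
definition fima_dist :: "nat \<Rightarrow> real \<Rightarrow> real \<Rightarrow> real measure \<Rightarrow> real measure \<Rightarrow> real \<Rightarrow> real measure" where
  "fima_dist n \<epsilon> \<delta> Zdist Ddist p =
     distr (Zdist \<Otimes>\<^sub>M (PiM {..<n} (\<lambda>_. uniform_measure lborel {0..1}) \<Otimes>\<^sub>M Ddist))
           borel (fima_value n \<epsilon> \<delta> p)"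

definition fima_quantile :: "nat \<Rightarrow> real \<Rightarrow> real \<Rightarrow> real measure \<Rightarrow> real measure \<Rightarrow> real \<Rightarrow> real \<Rightarrow> real" where
  "fima_quantile n \<epsilon> \<delta> Zdist Ddist \<alpha> p =
     Inf {v. measure (fima_dist n \<epsilon> \<delta> Zdist Ddist p) {..v} \<ge> \<alpha>}"

definition sample_prop :: "nat \<Rightarrow> (nat \<Rightarrow> bool) \<Rightarrow> real" where
  "sample_prop n x = real (card {i \<in> {..<n}. x i}) / real n"

definition pi_hat :: "nat \<Rightarrow> real \<Rightarrow> (nat \<Rightarrow> bool) \<Rightarrow> real \<Rightarrow> real" where
  "pi_hat n \<epsilon> x z = sample_prop n x + (1 / real n) / \<epsilon> * z"

definition data_noise :: "nat \<Rightarrow> real \<Rightarrow> real measure \<Rightarrow> ((nat \<Rightarrow> bool) \<times> real) measure" where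
  "data_noise n \<theta>0 Zdist =
     PiM {..<n} (\<lambda>_. measure_pmf (bernoulli_pmf \<theta>0)) \<Otimes>\<^sub>M Zdist"

end

theory Submission
  imports Defs "HOL-Real_Asymp.Real_Asymp"
begin

text \<open>Let \<open>N\<close> be the number of successes in the data and \<open>N'\<close> the number of simulated uniforms
  below \<open>\<theta>0\<close>; both are binomial with parameters \<open>n\<close> and \<open>\<theta>0\<close>. The \<open>k\<close>-th order statistic is below
  \<open>\<theta>0\<close> iff \<open>k \<le> N'\<close>, so up to a shift of the argument by a constant the conditional probability of
  \<open>\<theta>-hat < \<theta>0\<close> given \<open>\<pi>-hat = p\<close> is the tail of \<open>N'\<close> at \<open>n p\<close>, provided the noise \<open>Z*/\<epsilon>\<close> is bounded by
  \<open>M\<close>. Since \<open>n \<pi>-hat\<close> differs from \<open>N\<close> by the tight quantity \<open>Z/\<epsilon>\<close>, the event \<open>\<theta>0 \<le> \<theta>-hat_\<alpha>\<close> is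
  asymptotically the event that the binomial tail at \<open>N\<close> is below \<open>\<alpha>\<close>. All shifts are \<open>O(1)\<close>, hence
  invisible on the scale \<open>sqrt n\<close> of the central limit theorem, which is applied to \<open>N\<close> and \<open>N'\<close>.\<close>

section \<open>Order statistics as counts\<close>

text \<open>In a sorted list the indices of the entries below \<open>t\<close> form an initial
  segment, and index \<open>k - 1\<close> lies in it iff the segment has at least \<open>k\<close>
  elements.\<close>

lemma sorted_nth_less_iff:
  fixes xs :: "'a::linorder list"
  assumes "sorted xs" "1 \<le> k" "k \<le> length xs"
  shows "xs ! (k - 1) < t \<longleftrightarrow> k \<le> length (filter (\<lambda>x. x < t) xs)"
proof -
  let ?I = "{i. i < length xs \<and> xs ! i < t}"
  show ?thesis
  proof (cases "xs ! (k - 1) < t")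
    case True
    then have "{..<k} \<subseteq> ?I"
      using assms by (auto intro!: order.strict_trans1[OF sorted_nth_mono True])
    then have "card {..<k} \<le> card ?I"
      by (intro card_mono) auto
    with True show ?thesis by (simp add: length_filter_conv_card)
  next
    case False
    have "i < k - 1" if "i < length xs" "xs ! i < t" for i
    proof (rule ccontr)
      assume "\<not> i < k - 1"
      then have "xs ! (k - 1) \<le> xs ! i"
        using that assms by (intro sorted_nth_mono) auto
      with that False show False by auto
    qed
    then have "card ?I \<le> card {..<k - 1}"
      by (intro card_mono) auto
    with False assms show ?thesis by (auto simp: length_filter_conv_card)
  qed
qed

text \<open>Out of range, \<open>xs ! k\<close> depends on \<open>xs\<close> through its length only; this makes
  order statistics measurable at every index, including the junk ones.\<close>

lemma nth_beyond: "length xs \<le> k \<Longrightarrow> xs ! k = [] ! (k - length xs)"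
proof (induction xs arbitrary: k)
  case (Cons x xs)
  then show ?case by (cases k) auto
qed simp

text \<open>Turns order statistics into counts of hits in \<open>{..<t}\<close>, the form in which
  the central limit theorem and measurability are available.\<close>

lemma order_stat_less_iff:
  assumes "1 \<le> k" "k \<le> n"
  shows "order_stat n u k < t \<longleftrightarrow> k \<le> card {i \<in> {..<n}. u i \<in> {..<t}}"
proof -
  have "order_stat n u k < t \<longleftrightarrow> k \<le> length (filter (\<lambda>x. x < t) (sort (map u [0..<n])))"
    unfolding order_stat_def using assms by (intro sorted_nth_less_iff) auto
  also have "length (filter (\<lambda>x. x < t) (sort (map u [0..<n])))
      = card {i \<in> {..<n}. u i \<in> {..<t}}"
    by (simp add: filter_sort length_filter_conv_card) (auto intro!: arg_cong[where f = card])
  finally show ?thesis .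
qed

lemma order_stat_mono:
  "\<lbrakk>1 \<le> j; j \<le> k; k \<le> n\<rbrakk> \<Longrightarrow> order_stat n u j \<le> order_stat n u k"
  unfolding order_stat_def by (intro sorted_nth_mono) auto

section \<open>Measurability of counts, order statistics and the FIMA value\<close>

lemma measurable_count [measurable]:
  fixes n :: nat
  assumes [measurable]: "A \<in> sets P"
  shows "(\<lambda>u. card {i \<in> {..<n}. u i \<in> A}) \<in> measurable (PiM {..<n} (\<lambda>_. P)) (count_space UNIV)"
proof -
  have "(\<lambda>u. \<Sum>i<n. if u i \<in> A then 1 else 0 :: nat) \<in> measurable (PiM {..<n} (\<lambda>_. P)) (count_space UNIV)"
    by measurable
  also have "(\<lambda>u. \<Sum>i<n. if u i \<in> A then 1 else 0 :: nat) = (\<lambda>u. card {i \<in> {..<n}. u i \<in> A})"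
    by (subst sum.inter_filter[symmetric]) auto
  finally show ?thesis .
qed

lemma borel_measurable_order_stat_ext:
  assumes [measurable_cong]: "sets P = sets borel"
  shows "(\<lambda>u. order_stat_ext n \<delta> u k) \<in> borel_measurable (PiM {..<n} (\<lambda>_. P))"
proof -
  consider "k = 0" | "k = n + 1" | "1 \<le> k" "k \<le> n" | "n + 1 < k" by linarith
  then show ?thesis
  proof cases
    case 3
    have "{u \<in> space (PiM {..<n} (\<lambda>_. P)). order_stat n u k < t} \<in> sets (PiM {..<n} (\<lambda>_. P))" for t
      unfolding order_stat_less_iff[OF 3] by measurable
    then have "(\<lambda>u. order_stat n u k) \<in> borel_measurable (PiM {..<n} (\<lambda>_. P))"
      by (intro borel_measurableI_less)
    with 3 show ?thesis by (simp add: order_stat_ext_def)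
  next
    case 4
    then have "order_stat_ext n \<delta> u k = [] ! (k - 1 - n)" for u
      unfolding order_stat_ext_def order_stat_def by (subst nth_beyond) auto
    then show ?thesis by simp
  qed (auto simp: order_stat_ext_def)
qed

text \<open>Joint measurability in \<open>p\<close> and the auxiliary randomness is what later makes
  the conditional law a measurable kernel in \<open>p\<close>.\<close>

lemma borel_measurable_fima_value:
  assumes [measurable_cong]: "sets P = sets borel" "sets Q = sets borel" "sets R = sets borel"
  shows "(\<lambda>(p, \<omega>). fima_value n \<epsilon> \<delta> p \<omega>)
    \<in> borel_measurable (borel \<Otimes>\<^sub>M (Q \<Otimes>\<^sub>M (PiM {..<n} (\<lambda>_. P) \<Otimes>\<^sub>M R)))"
proof -
  note [measurable] = borel_measurable_order_stat_ext[OF assms(1)]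
  \<comment> \<open>The index is itself random. Splitting over its countably many values requires
    measurability at every fixed index, also beyond \<open>n + 1\<close>.\<close>
  have [measurable]: "(\<lambda>x. order_stat_ext n \<delta> (f x) (g x)) \<in> borel_measurable M"
    if [measurable]: "f \<in> measurable M (PiM {..<n} (\<lambda>_. P))" "g \<in> measurable M (count_space UNIV)"
    for f g and M :: "(real \<times> real \<times> (nat \<Rightarrow> real) \<times> real) measure"
    using measurable_compose_countable[of "\<lambda>k x. order_stat_ext n \<delta> (f x) k" M borel g] by measurable
  show ?thesis
    unfolding fima_value_def Let_def case_prod_beta by measurable
qed

section \<open>Central limit theorem for counts\<close>

text \<open>The central limit theorem for the indicators of \<open>A\<close>. General
  \<open>P\<close> and \<open>A\<close> let it serve both the Bernoulli data and the simulated
  uniforms. It needs one infinite sequence, so the proof lives on the product over all naturals and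
  returns to \<open>n\<close> coordinates at the end.\<close>

lemma binomial_clt:
  fixes P :: "'a measure"
  assumes "prob_space P" and A [measurable]: "A \<in> sets P" and p: "measure P A = p" "0 < p" "p < 1"
  shows "(\<lambda>n. measure (PiM {..<n} (\<lambda>_. P))
      {x \<in> space (PiM {..<n} (\<lambda>_. P)).
        real (card {i \<in> {..<n}. x i \<in> A}) \<le> real n * p + c * sqrt (real n * (p * (1 - p)))})
    \<longlonglongrightarrow> cdf std_normal_distribution c"
proof -
  interpret P0: prob_space P by fact
  interpret prod: product_prob_space "\<lambda>_::nat. P" UNIV by standard
  let ?M = "PiM (UNIV::nat set) (\<lambda>_. P)"
  define X :: "nat \<Rightarrow> (nat \<Rightarrow> 'a) \<Rightarrow> real" where "X i x = indicator A (x i)" for i x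
  have X_meas [measurable]: "X i \<in> borel_measurable ?M" for i
    unfolding X_def by measurable
  have distr: "distr ?M borel (X i) = distr P borel (indicator A)" for i
  proof -
    have "distr ?M borel (X i) = distr (distr ?M P (\<lambda>x. x i)) borel (indicator A)"
      by (subst distr_distr) (auto simp: comp_def X_def[abs_def])
    then show ?thesis by (simp add: prod.PiM_component)
  qed
  have expect: "(\<integral>x. f (X i x) \<partial>?M) = (\<integral>x. f (indicator A x) \<partial>P)"
    if [measurable]: "f \<in> borel_measurable borel" for f :: "real \<Rightarrow> real" and i
  proof -
    have "(\<integral>x. f (X i x) \<partial>?M) = (\<integral>y. f y \<partial>distr ?M borel (X i))"
      by (subst integral_distr) auto
    then show ?thesis unfolding distr by (subst (asm) integral_distr) auto
  qed
  have mean: "P0.expectation (indicator A) = p"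
    using p by simp
  have indep_id: "prob_space.indep_vars ?M (\<lambda>_. P) (\<lambda>i x. x i) UNIV"
    by (subst prod.P.indep_vars_iff_distr_eq_PiM') (auto simp: prod.PiM_component restrict_def distr_id2)
  have indep: "prob_space.indep_vars ?M (\<lambda>_. borel) X UNIV"
    unfolding X_def[abs_def]
    by (rule prod.P.indep_vars_compose2[OF indep_id]) measurable
  define \<sigma> where "\<sigma> = sqrt (p * (1 - p))"
  have \<sigma>: "\<sigma> > 0" "\<sigma>\<^sup>2 = p * (1 - p)"
    using p by (auto simp: \<sigma>_def)
  have E: "(\<integral>x. X i x \<partial>?M) = p" for i
    using expect[of "\<lambda>y. y" i] mean by simp
  have V: "(\<integral>x. (X i x - p)\<^sup>2 \<partial>?M) = \<sigma>\<^sup>2" for i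
  proof -
    have "(\<integral>x. (X i x - p)\<^sup>2 \<partial>?M) = (\<integral>x. (indicator A x - p)\<^sup>2 \<partial>P)"
      by (rule expect) simp
    also have "\<dots> = (\<integral>x. (1 - 2 * p) * indicator A x + p\<^sup>2 \<partial>P)"
      by (intro Bochner_Integration.integral_cong) (auto simp: indicator_def power2_eq_square algebra_simps)
    also have "\<dots> = (1 - 2 * p) * p + p\<^sup>2"
      using p by (simp add: P0.prob_space P0.emeasure_eq_measure)
    also have "\<dots> = \<sigma>\<^sup>2"
      unfolding \<sigma>(2) by (simp add: power2_eq_square algebra_simps)
    finally show ?thesis .
  qed
  have "weak_conv_m (\<lambda>n. distr ?M borel (\<lambda>x. (\<Sum>i<n. X i x - p) / sqrt (n * \<sigma>\<^sup>2))) std_normal_distribution"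
  proof (rule prod.P.central_limit_theorem[OF indep E \<sigma>(1)])
    show "integrable ?M (\<lambda>x. (X n x)\<^sup>2)" for n
      by (rule prod.P.integrable_const_bound[where B = 1]) (auto simp: X_def indicator_def)
    show "prod.P.variance (X n) = \<sigma>\<^sup>2" for n
      using V[of n] by (simp add: E)
  qed (rule distr)
  \<comment> \<open>The normal law has no atoms, so weak convergence gives convergence of the
    distribution functions at every \<open>c\<close>.\<close>
  moreover have "isCont (cdf std_normal_distribution) c"
  proof -
    interpret N: real_distribution std_normal_distribution by (rule real_dist_normal_dist)
    show ?thesis by (simp add: N.isCont_cdf measure_def emeasure_density nn_integral_indicator_singleton)
  qed
  ultimately have lim: "(\<lambda>n. cdf (distr ?M borel (\<lambda>x. (\<Sum>i<n. X i x - p) / sqrt (n * \<sigma>\<^sup>2))) c)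
      \<longlonglongrightarrow> cdf std_normal_distribution c"
    by (simp add: weak_conv_m_def weak_conv_def)
  show ?thesis
  proof (rule Lim_transform_eventually[OF lim eventually_sequentiallyI[of 1]])
    \<comment> \<open>For \<open>n = 0\<close> the normalising factor is zero, and the two events
      need not agree.\<close>
    fix n :: nat assume n: "1 \<le> n"
    let ?N = "PiM {..<n} (\<lambda>_. P)"
    have s: "sqrt (n * \<sigma>\<^sup>2) > 0" using n \<sigma>(1) by simp
    have sum: "(\<Sum>i<n. X i x - p) = real (card {i \<in> {..<n}. x i \<in> A}) - n * p" for x
      by (simp add: X_def sum_subtractf indicator_def sum.If_cases Int_def)
    let ?S = "{x \<in> space ?N. real (card {i \<in> {..<n}. x i \<in> A}) \<le> real n * p + c * sqrt (real n * (p * (1 - p)))}"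
    have restr: "card {i. (i < n \<longrightarrow> x i \<in> A) \<and> i < n} = card {i. i < n \<and> x i \<in> A}" for x :: "nat \<Rightarrow> 'a"
      by (rule arg_cong[where f = card]) auto
    \<comment> \<open>The event depends on the first \<open>n\<close> coordinates only, and
      restriction to them pushes the infinite product forward to the finite one.\<close>
    have "measure ?N ?S = measure (distr ?M ?N (\<lambda>x. restrict x {..<n})) ?S"
      by (subst prod.distr_PiM_restrict_finite) auto
    also have "\<dots> = measure ?M ((\<lambda>x. restrict x {..<n}) -` ?S \<inter> space ?M)"
      by (subst measure_distr) (auto simp: measurable_restrict_subset)
    also have "(\<lambda>x. restrict x {..<n}) -` ?S \<inter> space ?M
        = (\<lambda>x. (\<Sum>i<n. X i x - p) / sqrt (n * \<sigma>\<^sup>2)) -` {..c} \<inter> space ?M"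
      using s unfolding sum \<sigma>(2)
      by (auto simp: field_simps restr space_PiM)
    also have "measure ?M \<dots> = cdf (distr ?M borel (\<lambda>x. (\<Sum>i<n. X i x - p) / sqrt (n * \<sigma>\<^sup>2))) c"
      unfolding cdf_def by (subst measure_distr) auto
    finally show "cdf (distr ?M borel (\<lambda>x. (\<Sum>i<n. X i x - p) / sqrt (n * \<sigma>\<^sup>2))) c = measure ?N ?S"
      by simp
  qed
qed

section \<open>Normal quantiles and quantiles as infima\<close>

lemma std_normal_cdf_surj:
  assumes "0 < q" "q < 1"
  obtains c where "cdf std_normal_distribution c = q"
proof -
  interpret N: real_distribution std_normal_distribution by (rule real_dist_normal_dist)
  let ?F = "cdf std_normal_distribution"
  have cont: "isCont ?F x" for x
    by (simp add: N.isCont_cdf measure_def emeasure_density nn_integral_indicator_singleton)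
  obtain a where a: "?F a < q"
    using order_tendstoD(2)[OF N.cdf_lim_at_bot, of q] assms
    by (auto dest: eventually_happens'[rotated])
  obtain b where b: "q < ?F b"
    using order_tendstoD(1)[OF N.cdf_lim_at_top_prob, of q] assms
    by (auto dest: eventually_happens'[rotated])
  have "a \<le> b"
    using a b N.cdf_nondecreasing[of b a] by linarith
  then show thesis
    using IVT[of ?F a q b] a b cont that by auto
qed

text \<open>The limits 0 and 1 of the distribution function make the set under \<open>Inf\<close>
  bounded below and nonempty, so \<open>Inf\<close> is a genuine greatest lower bound.\<close>

lemma le_quantile_iff:
  fixes \<mu> :: "real measure"
  assumes "real_distribution \<mu>" "0 < \<alpha>" "\<alpha> < 1"
  shows "\<theta> \<le> Inf {v. \<alpha> \<le> measure \<mu> {..v}} \<longleftrightarrow> (\<forall>v<\<theta>. measure \<mu> {..v} < \<alpha>)"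
proof -
  interpret real_distribution \<mu> by fact
  let ?S = "{v. \<alpha> \<le> cdf \<mu> v}"
  obtain a where a: "cdf \<mu> a < \<alpha>"
    using order_tendstoD(2)[OF cdf_lim_at_bot, of \<alpha>] assms
    by (auto dest: eventually_happens'[rotated])
  obtain b where b: "\<alpha> < cdf \<mu> b"
    using order_tendstoD(1)[OF cdf_lim_at_top_prob, of \<alpha>] assms
    by (auto dest: eventually_happens'[rotated])
  have "a \<le> v" if "v \<in> ?S" for v
    using a that cdf_nondecreasing[of v a] by force
  then have bdd: "bdd_below ?S" by (rule bdd_belowI)
  have ne: "?S \<noteq> {}" using b less_imp_le by blast
  have "\<theta> \<le> Inf ?S \<longleftrightarrow> (\<forall>v\<in>?S. \<theta> \<le> v)"
    by (rule le_cInf_iff[OF ne bdd])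
  then show ?thesis unfolding cdf_def by (auto simp: not_le[symmetric])
qed

text \<open>By monotonicity of the distribution function and density of the rationals, countably
  many conditions suffice; this gives measurability of the quantile event.\<close>

lemma le_quantile_iff_rat:
  fixes \<mu> :: "real measure"
  assumes "real_distribution \<mu>" "0 < \<alpha>" "\<alpha> < 1"
  shows "\<theta> \<le> Inf {v. \<alpha> \<le> measure \<mu> {..v}} \<longleftrightarrow>
    (\<forall>q::rat. of_rat q < \<theta> \<longrightarrow> measure \<mu> {..of_rat q} < \<alpha>)"
  unfolding le_quantile_iff[OF assms]
proof safe
  interpret real_distribution \<mu> by fact
  fix v assume *: "\<forall>q::rat. of_rat q < \<theta> \<longrightarrow> measure \<mu> {..of_rat q} < \<alpha>" and "v < \<theta>"
  then obtain q where q: "v < of_rat q" "of_rat q < \<theta>"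
    using of_rat_dense by blast
  have "measure \<mu> {..v} \<le> measure \<mu> {..of_rat q}"
    using q by (intro finite_measure_mono) auto
  with * q show "measure \<mu> {..v} < \<alpha>" by force
qed auto

section \<open>Position of the FIMA value relative to the true parameter\<close>

text \<open>Here \<open>n * t\<close> is within \<open>M\<close> of \<open>n * p\<close>, and the
  value lies between the order statistics \<open>a\<close> and \<open>b\<close> of ranks
  \<open>k\<close> and \<open>k + 1\<close>, with \<open>k\<close> the floor of
  \<open>n * t\<close>. If \<open>N < k\<close> then \<open>a\<close> is at least \<theta>; if
  \<open>k + 1 \<le> N\<close> then \<open>b\<close> is below \<theta>. The constants 2 and 1 cover
  the rounding. The edge conditions force \<open>1 \<le> k < n\<close>, which excludes truncation
  and the conventional end points.\<close>

lemma fima_value_bounds: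
  fixes u :: "nat \<Rightarrow> real" and \<theta> :: real
  assumes "0 < \<epsilon>" "\<bar>z\<bar> \<le> \<epsilon> * M" "0 \<le> d" "d \<le> 1"
    and edge: "1 \<le> real n * p - M" "real n * p + M < real n"
  defines "N \<equiv> real (card {i \<in> {..<n}. u i \<in> {..<\<theta>}})"
  shows "N \<le> real n * p - M - 2 \<Longrightarrow> \<theta> \<le> fima_value n \<epsilon> \<delta> p (z, u, d)"
    and "real n * p + M + 1 < N \<Longrightarrow> fima_value n \<epsilon> \<delta> p (z, u, d) < \<theta>"
proof -
  define t where "t = p - (1 / real n) / \<epsilon> * z"
  define k where "k = nat \<lfloor>real n * t\<rfloor>"
  define a where "a = order_stat n u k"
  define b where "b = order_stat n u (k + 1)"
  have "M \<ge> 0"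
    using order_trans[OF abs_ge_zero assms(2)] assms(1) by (simp add: zero_le_mult_iff)
  \<comment> \<open>For \<open>n = 0\<close> the first edge condition would read
    \<open>1 \<le> - M\<close>.\<close>
  have n: "n > 0" using edge \<open>M \<ge> 0\<close> by (cases n) auto
  have "\<bar>z / \<epsilon>\<bar> \<le> M" using assms(1,2) by (simp add: field_simps abs_divide)
  moreover have nt: "real n * t = real n * p - z / \<epsilon>"
    using n by (simp add: t_def field_simps)
  ultimately have nt: "real n * p - M \<le> real n * t" "real n * t \<le> real n * p + M"
    by linarith+
  with edge have nt1: "1 \<le> real n * t" "real n * t < real n" by linarith+
  then have t: "0 \<le> t" "t \<le> 1"
    using n zero_le_mult_iff[of "real n" t] mult_less_cancel_left_pos[of "real n" t 1] by auto
  have k: "real k \<le> real n * t" "real n * t < real k + 1" "1 \<le> k" "k < n"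
    using nt1 unfolding k_def by linarith+
  have "nat \<lfloor>real n * t + 1\<rfloor> = k + 1"
    using nt1 unfolding k_def by linarith
  then have val: "fima_value n \<epsilon> \<delta> p (z, u, d) = a + d * (b - a)"
    using t k unfolding fima_value_def Let_def prod.case t_def[symmetric] k_def[symmetric]
    by (simp add: order_stat_ext_def a_def b_def)
  have "a \<le> b" unfolding a_def b_def using k by (intro order_stat_mono) auto
  then have d: "0 \<le> d * (b - a)" "d * (b - a) \<le> b - a"
    using assms(3,4) by (auto intro: mult_left_le_one_le)
  show "\<theta> \<le> fima_value n \<epsilon> \<delta> p (z, u, d)" if "N \<le> real n * p - M - 2"
  proof -
    have "N < real k" using that nt k by linarith
    then have "\<not> a < \<theta>"
      using k unfolding a_def by (subst order_stat_less_iff) (auto simp: N_def)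
    then show ?thesis using val d by linarith
  qed
  show "fima_value n \<epsilon> \<delta> p (z, u, d) < \<theta>" if "real n * p + M + 1 < N"
  proof -
    have "real (k + 1) \<le> N" using that nt k by linarith
    then have "b < \<theta>"
      using k unfolding b_def by (subst order_stat_less_iff) (auto simp: N_def)
    then show ?thesis using val d by linarith
  qed
qed

section \<open>Uniform draws, binomial distribution functions and product estimates\<close>

abbreviation unif :: "real measure" where
  "unif \<equiv> uniform_measure lborel {0..1}"

lemma prob_space_unif: "prob_space unif"
  by (rule prob_space_uniform_measure) auto

lemma measure_unif_lessThan:
  assumes "0 < \<theta>" "\<theta> < 1"
  shows "measure unif {..<\<theta>} = \<theta>"
proof -
  have "{0..1} \<inter> {..<\<theta>} = {0..<\<theta>}" using assms by auto
  then show ?thesis using assms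
    by (subst measure_uniform_measure) auto
qed

text \<open>The binomial distribution function with parameters \<open>n\<close> and
  \<open>measure P A\<close>, for probability measures \<open>P\<close> and measurable
  \<open>A\<close>, realised on the product space.\<close>

definition count_cdf :: "nat \<Rightarrow> 'a measure \<Rightarrow> 'a set \<Rightarrow> real \<Rightarrow> real" where
  "count_cdf n P A x = measure (PiM {..<n} (\<lambda>_. P))
     {u \<in> space (PiM {..<n} (\<lambda>_. P)). real (card {i \<in> {..<n}. u i \<in> A}) \<le> x}"

lemma count_cdf_mono:
  assumes "prob_space P" "A \<in> sets P" "x \<le> y"
  shows "count_cdf n P A x \<le> count_cdf n P A y"
proof -
  note [measurable] = assms(2)
  interpret prob_space "PiM {..<n} (\<lambda>_. P)" using assms(1) by (intro prob_space_PiM)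
  show ?thesis unfolding count_cdf_def
    using assms(3) by (intro finite_measure_mono) auto
qed

lemma measure_Times:
  assumes "sigma_finite_measure N" "A \<in> sets M" "B \<in> sets N"
  shows "measure (M \<Otimes>\<^sub>M N) (A \<times> B) = measure M A * measure N B"
  using assms
  by (simp add: measure_def sigma_finite_measure.emeasure_pair_measure_Times enn2real_mult)

text \<open>Intersecting with an independent event of probability at least \<open>1 - \<eta>\<close>
  costs at most \<eta>.\<close>

lemma mult_ge_diff:
  fixes a b \<eta> :: real
  assumes "1 - \<eta> \<le> a" "b \<le> 1" "a \<le> 1"
  shows "b - \<eta> \<le> a * b"
proof -
  have "(1 - a) * b \<le> (1 - a) * 1" using assms by (intro mult_left_mono) auto
  then show ?thesis using assms by (simp add: algebra_simps)
qed

section \<open>Conditional law of theta-hat and its quantile\<close>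

locale fima =
  fixes \<theta> \<epsilon> \<alpha> :: real and Zdist Ddist :: "real measure"
  assumes \<theta>: "0 < \<theta>" "\<theta> < 1" and \<epsilon>: "0 < \<epsilon>" and \<alpha>: "0 < \<alpha>" "\<alpha> < 1"
    and Z: "prob_space Zdist" "sets Zdist = sets borel"
    and D: "prob_space Ddist" "sets Ddist = sets borel" "emeasure Ddist {0..1} = 1"
begin

abbreviation "Us n \<equiv> PiM {..<n} (\<lambda>_. unif)"
abbreviation "aux n \<equiv> Zdist \<Otimes>\<^sub>M (Us n \<Otimes>\<^sub>M Ddist)"

lemma prob_Us: "prob_space (Us n)"
  by (intro prob_space_PiM prob_space_unif)

lemma prob_aux: "prob_space (aux n)"
  by (intro prob_space_pair Z D prob_Us)

lemma measurable_value [measurable]: "fima_value n \<epsilon> \<delta> p \<in> borel_measurable (aux n)"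
  using measurable_compose[OF measurable_Pair1' borel_measurable_fima_value[of unif Zdist Ddist n \<epsilon> \<delta>], of p]
  by (simp add: Z D)

lemma real_distribution_fima_dist: "real_distribution (fima_dist n \<epsilon> \<delta> Zdist Ddist p)"
  unfolding fima_dist_def by (rule prob_space.real_distribution_distr[OF prob_aux measurable_value])

lemma le_fima_quantile_iff:
  "\<theta> \<le> fima_quantile n \<epsilon> \<delta> Zdist Ddist \<alpha> p \<longleftrightarrow>
    (\<forall>v<\<theta>. measure (fima_dist n \<epsilon> \<delta> Zdist Ddist p) {..v} < \<alpha>)"
  unfolding fima_quantile_def by (rule le_quantile_iff[OF real_distribution_fima_dist \<alpha>])

text \<open>The conditional law is a measurable kernel in \<open>p\<close>, so its distribution
  function at each fixed point is measurable in \<open>p\<close>; the rational criterion then gives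
  a countable intersection.\<close>

lemma borel_le_fima_quantile:
  "{p. \<theta> \<le> fima_quantile n \<epsilon> \<delta> Zdist Ddist \<alpha> p} \<in> sets borel"
proof -
  have "aux n \<in> space (subprob_algebra (aux n))"
    using prob_space_imp_subprob_space[OF prob_aux] by (simp add: space_subprob_algebra)
  then have F: "fima_dist n \<epsilon> \<delta> Zdist Ddist \<in> measurable borel (subprob_algebra borel)"
    unfolding fima_dist_def
    by (intro measurable_distr2[where M = "aux n"] borel_measurable_fima_value measurable_const)
       (simp_all add: Z D borel_measurable_fima_value)
  have [measurable]: "(\<lambda>p. measure (fima_dist n \<epsilon> \<delta> Zdist Ddist p) {..v}) \<in> borel_measurable borel" for v
    by (rule measurable_compose[OF F measurable_measure_subprob_algebra]) simp
  have "{p \<in> space borel. \<forall>q::rat. of_rat q < \<theta> \<longrightarrow> measure (fima_dist n \<epsilon> \<delta> Zdist Ddist p) {..of_rat q} < \<alpha>} \<in> sets borel"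
    by measurable
  then show ?thesis
    unfolding fima_quantile_def le_quantile_iff_rat[OF real_distribution_fima_dist \<alpha>] by simp
qed

lemma measure_aux_rect:
  assumes z: "1 - \<eta> \<le> measure Zdist {z. \<bar>z\<bar> \<le> \<epsilon> * M}" and B: "B \<in> sets (Us n)"
  shows "measure (Us n) B - \<eta> \<le> measure (aux n) ({z. \<bar>z\<bar> \<le> \<epsilon> * M} \<times> (B \<times> {0..1}))"
proof -
  interpret Z: prob_space Zdist by (rule Z)
  interpret D: prob_space Ddist by (rule D)
  interpret U: prob_space "Us n" by (rule prob_Us)
  interpret UD: pair_prob_space "Us n" Ddist ..
  interpret ZUD: pair_prob_space Zdist "Us n \<Otimes>\<^sub>M Ddist" ..
  have [measurable]: "{z. \<bar>z\<bar> \<le> \<epsilon> * M} \<in> sets Zdist" "{0..1} \<in> sets Ddist"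
    unfolding Z D by measurable
  have "measure Ddist {0..1} = 1" using D by (simp add: measure_def)
  then have "measure (aux n) ({z. \<bar>z\<bar> \<le> \<epsilon> * M} \<times> (B \<times> {0..1})) =
      measure Zdist {z. \<bar>z\<bar> \<le> \<epsilon> * M} * measure (Us n) B"
    using B by (simp add: measure_Times UD.sigma_finite_measure_axioms D.sigma_finite_measure_axioms)
  then show ?thesis
    using mult_ge_diff[OF z] by simp
qed

text \<open>On the rectangle where the noise is bounded by \<open>\<epsilon> * M\<close> and
  \<open>D\<close> lies in the unit interval, the count decides on which side of \<theta> the value
  falls. Leaving that rectangle costs \<eta>. The upper bound comes from a rectangle inside the
  complement of \<open>?V\<close>.\<close>

lemma fima_dist_bounds:
  assumes z: "1 - \<eta> \<le> measure Zdist {z. \<bar>z\<bar> \<le> \<epsilon> * M}"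
    and edge: "1 \<le> real n * p - M" "real n * p + M < real n"
  shows "measure (fima_dist n \<epsilon> \<delta> Zdist Ddist p) {..<\<theta>}
      \<le> 1 - count_cdf n unif {..<\<theta>} (real n * p - M - 2) + \<eta>" (is ?upper)
    and "1 - count_cdf n unif {..<\<theta>} (real n * p + M + 1) - \<eta>
      \<le> measure (fima_dist n \<epsilon> \<delta> Zdist Ddist p) {..<\<theta>}" (is ?lower)
proof -
  interpret U: prob_space "Us n" by (rule prob_Us)
  interpret aux: prob_space "aux n" by (rule prob_aux)
  let ?N = "\<lambda>u. real (card {i \<in> {..<n}. u i \<in> {..<\<theta>}})"
  let ?G = "\<lambda>B. {z. \<bar>z\<bar> \<le> \<epsilon> * M} \<times> (B \<times> {0..1})"
  let ?V = "{\<omega> \<in> space (aux n). fima_value n \<epsilon> \<delta> p \<omega> < \<theta>}"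
  have V: "measure (fima_dist n \<epsilon> \<delta> Zdist Ddist p) {..<\<theta>} = measure (aux n) ?V"
    unfolding fima_dist_def
    by (subst measure_distr[OF measurable_value]) (simp_all add: vimage_def Int_def conj_commute)
  have space: "space Zdist = UNIV" "space Ddist = UNIV"
    using sets_eq_imp_space_eq[OF Z(2)] sets_eq_imp_space_eq[OF D(2)] by simp_all
  have [measurable]: "?V \<in> sets (aux n)" by measurable
  let ?L = "{u \<in> space (Us n). ?N u \<le> real n * p - M - 2}"
  let ?R = "{u \<in> space (Us n). \<not> ?N u \<le> real n * p + M + 1}"
  have [measurable]: "{..<\<theta>} \<in> sets unif" by simp
  have [measurable]: "?L \<in> sets (Us n)" "?R \<in> sets (Us n)" by measurable
  have "measure (Us n) ?L - \<eta> \<le> measure (aux n) (?G ?L)"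
    by (rule measure_aux_rect[OF z]) measurable
  also have "\<dots> \<le> measure (aux n) (space (aux n) - ?V)"
  proof (rule aux.finite_measure_mono)
    have "\<not> fima_value n \<epsilon> \<delta> p (z, u, d) < \<theta>"
      if "\<bar>z\<bar> \<le> \<epsilon> * M" "0 \<le> d" "d \<le> 1" "u \<in> ?L" for z u d
      using fima_value_bounds(1)[OF \<epsilon> that(1-3) edge] that(4) by (simp add: not_less)
    then show "?G ?L \<subseteq> space (aux n) - ?V"
      by (auto simp: space_pair_measure space)
  qed measurable
  also have "\<dots> = 1 - measure (aux n) ?V"
    by (rule aux.prob_compl) measurable
  finally show ?upper unfolding V count_cdf_def by simp
  have "measure (Us n) ?R = 1 - count_cdf n unif {..<\<theta>} (real n * p + M + 1)"
    unfolding count_cdf_def by (rule U.prob_neg) measurable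
  moreover have "measure (Us n) ?R - \<eta> \<le> measure (aux n) (?G ?R)"
    by (rule measure_aux_rect[OF z]) measurable
  moreover have "\<dots> \<le> measure (aux n) ?V"
  proof (rule aux.finite_measure_mono)
    have "fima_value n \<epsilon> \<delta> p (z, u, d) < \<theta>"
      if "\<bar>z\<bar> \<le> \<epsilon> * M" "0 \<le> d" "d \<le> 1" "u \<in> ?R" for z u d
      using fima_value_bounds(2)[OF \<epsilon> that(1-3) edge] that(4) by (simp add: not_le)
    then show "?G ?R \<subseteq> ?V"
      by (auto simp: space_pair_measure space)
  qed measurable
  ultimately show ?lower unfolding V by simp
qed

text \<open>Whether the quantile reaches \<theta> is decided by comparing the mass of
  \<open>{..<\<theta>}\<close> with \<alpha>; the margin \<eta> pays for the noise.\<close>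

lemma fima_quantile_cases:
  assumes z: "1 - \<eta> \<le> measure Zdist {z. \<bar>z\<bar> \<le> \<epsilon> * M}"
    and edge: "1 \<le> real n * p - M" "real n * p + M < real n"
  shows "1 - \<alpha> + \<eta> < count_cdf n unif {..<\<theta>} (real n * p - M - 2)
      \<Longrightarrow> \<theta> \<le> fima_quantile n \<epsilon> \<delta> Zdist Ddist \<alpha> p"
    and "count_cdf n unif {..<\<theta>} (real n * p + M + 1) < 1 - \<alpha> - \<eta>
      \<Longrightarrow> \<not> \<theta> \<le> fima_quantile n \<epsilon> \<delta> Zdist Ddist \<alpha> p"
proof -
  let ?F = "fima_dist n \<epsilon> \<delta> Zdist Ddist p"
  interpret F: real_distribution ?F by (rule real_distribution_fima_dist)
  note bounds = fima_dist_bounds[OF z edge, of \<delta>]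
  show "\<theta> \<le> fima_quantile n \<epsilon> \<delta> Zdist Ddist \<alpha> p"
    if "1 - \<alpha> + \<eta> < count_cdf n unif {..<\<theta>} (real n * p - M - 2)"
    unfolding le_fima_quantile_iff
  proof safe
    fix v assume "v < \<theta>"
    then have "measure ?F {..v} \<le> measure ?F {..<\<theta>}"
      by (intro F.finite_measure_mono) auto
    with that bounds(1) show "measure ?F {..v} < \<alpha>" by linarith
  qed
  show "\<not> \<theta> \<le> fima_quantile n \<epsilon> \<delta> Zdist Ddist \<alpha> p"
    if "count_cdf n unif {..<\<theta>} (real n * p + M + 1) < 1 - \<alpha> - \<eta>"
  proof -
    have "\<alpha> < measure ?F {..<\<theta>}" using that bounds(2) by linarith
    \<comment> \<open>The mass of \<open>{..<\<theta>}\<close> is the left limit of the distribution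
      function, so \<alpha> is already exceeded at some \<open>v < \<theta>\<close>.\<close>
    then have "\<forall>\<^sub>F v in at_left \<theta>. \<alpha> < cdf ?F v \<and> v < \<theta>"
      by (intro eventually_conj order_tendstoD(1)[OF F.cdf_at_left])
         (auto simp: eventually_at_filter)
    then obtain v where "\<alpha> < cdf ?F v" "v < \<theta>"
      by (auto dest: eventually_happens'[rotated])
    then show ?thesis unfolding le_fima_quantile_iff cdf_def by force
  qed
qed

text \<open>Continuity from below: the intervals \<open>\<bar>z\<bar> \<le> \<epsilon> * i\<close>
  increase to the whole line.\<close>

lemma noise_tight:
  assumes "0 < \<eta>"
  obtains M where "0 \<le> M" "1 - \<eta> \<le> measure Zdist {z. \<bar>z\<bar> \<le> \<epsilon> * M}"
proof -
  interpret Z: prob_space Zdist by (rule Z)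
  have meas: "{z. \<bar>z\<bar> \<le> \<epsilon> * real i} \<in> sets Zdist" for i
    unfolding Z by measurable
  have "(\<Union>i. {z. \<bar>z\<bar> \<le> \<epsilon> * real i}) = space Zdist"
  proof -
    have "\<exists>i. \<bar>z\<bar> \<le> \<epsilon> * real i" for z
      using real_arch_simple[of "\<bar>z\<bar> / \<epsilon>"] \<epsilon> by (auto simp: field_simps)
    then show ?thesis using sets_eq_imp_space_eq[OF Z(2)] by auto
  qed
  moreover have "(\<lambda>i. measure Zdist {z. \<bar>z\<bar> \<le> \<epsilon> * real i})
      \<longlonglongrightarrow> measure Zdist (\<Union>i. {z. \<bar>z\<bar> \<le> \<epsilon> * real i})"
    using meas \<epsilon> by (intro Z.finite_Lim_measure_incseq)
      (auto simp: incseq_def intro: order_trans mult_left_mono)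
  ultimately have "(\<lambda>i. measure Zdist {z. \<bar>z\<bar> \<le> \<epsilon> * real i}) \<longlonglongrightarrow> 1"
    by (simp add: Z.prob_space)
  then have "\<forall>\<^sub>F i in sequentially. 1 - \<eta> < measure Zdist {z. \<bar>z\<bar> \<le> \<epsilon> * real i}"
    using assms by (intro order_tendstoD(1)) auto
  then obtain i where "1 - \<eta> < measure Zdist {z. \<bar>z\<bar> \<le> \<epsilon> * real i}"
    by (auto dest: eventually_happens'[rotated])
  then show thesis by (intro that[of "real i"]) auto
qed

end

section \<open>From the conditional law to asymptotic coverage\<close>

text \<open>Constants are negligible against \<open>sqrt n\<close>, and \<open>sqrt n\<close>
  against \<open>n\<close>. The first part absorbs shifts; the other two keep the central limit
  scale away from 0 and \<open>n\<close>.\<close>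

lemma eventually_scale:
  fixes v c c' C \<theta> :: real
  assumes "0 < v"
  shows "c < c' \<Longrightarrow> \<forall>\<^sub>F n in sequentially. c * sqrt (real n * v) + C \<le> c' * sqrt (real n * v)"
    and "0 < \<theta> \<Longrightarrow> \<forall>\<^sub>F n in sequentially. C < real n * \<theta> + c * sqrt (real n * v)"
    and "\<theta> < 1 \<Longrightarrow> \<forall>\<^sub>F n in sequentially. real n * \<theta> + c * sqrt (real n * v) + C < real n"
proof -
  show "\<forall>\<^sub>F n in sequentially. c * sqrt (real n * v) + C \<le> c' * sqrt (real n * v)" if "c < c'"
  proof -
    have "filterlim (\<lambda>n. (c' - c) * sqrt (real n * v)) at_top sequentially"
      using assms that by real_asymp
    then show ?thesis by (simp add: filterlim_at_top algebra_simps)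
  qed
  show "\<forall>\<^sub>F n in sequentially. C < real n * \<theta> + c * sqrt (real n * v)" if "0 < \<theta>"
    using assms that by real_asymp
  show "\<forall>\<^sub>F n in sequentially. real n * \<theta> + c * sqrt (real n * v) + C < real n" if "\<theta> < 1"
  proof -
    have "\<forall>\<^sub>F n in sequentially. C < real n * (1 - \<theta>) + (-c) * sqrt (real n * v)"
      using assms that by real_asymp
    then show ?thesis by eventually_elim (simp add: algebra_simps)
  qed
qed

context fima begin

abbreviation "bern \<equiv> measure_pmf (bernoulli_pmf \<theta>)"
abbreviation "Xs n \<equiv> PiM {..<n} (\<lambda>_. bern)"

definition covered :: "nat \<Rightarrow> real \<Rightarrow> ((nat \<Rightarrow> bool) \<times> real) set" where
  "covered n \<delta> = {(x, z) \<in> space (data_noise n \<theta> Zdist).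
     \<theta> \<le> fima_quantile n \<epsilon> \<delta> Zdist Ddist \<alpha> (pi_hat n \<epsilon> x z)}"

lemma prob_data: "prob_space (data_noise n \<theta> Zdist)"
  unfolding data_noise_def
  by (intro prob_space_pair prob_space_PiM Z prob_space_measure_pmf)

lemma sets_covered: "covered n \<delta> \<in> sets (data_noise n \<theta> Zdist)"
proof -
  have [measurable_cong]: "sets Zdist = sets borel" by (rule Z)
  have [measurable]: "{True} \<in> sets bern" by simp
  \<comment> \<open>Writing success as membership in \<open>{True}\<close> brings the count into the
    form of \<open>measurable_count\<close>.\<close>
  have "sample_prop n = (\<lambda>x. real (card {i \<in> {..<n}. x i \<in> {True}}) / real n)"
    by (simp add: sample_prop_def fun_eq_iff)
  moreover have "(\<lambda>x. real (card {i \<in> {..<n}. x i \<in> {True}}) / real n) \<in> borel_measurable (Xs n)"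
    by measurable
  ultimately have [measurable]: "sample_prop n \<in> borel_measurable (Xs n)"
    by simp
  have [measurable]: "(\<lambda>xz. pi_hat n \<epsilon> (fst xz) (snd xz)) \<in> borel_measurable (Xs n \<Otimes>\<^sub>M Zdist)"
    unfolding pi_hat_def by measurable
  have "{xz \<in> space (Xs n \<Otimes>\<^sub>M Zdist). pi_hat n \<epsilon> (fst xz) (snd xz) \<in>
      {p. \<theta> \<le> fima_quantile n \<epsilon> \<delta> Zdist Ddist \<alpha> p}} \<in> sets (Xs n \<Otimes>\<^sub>M Zdist)"
    by (rule measurable_sets_Collect[where N = borel]) (simp_all add: borel_le_fima_quantile)
  also have "{xz \<in> space (Xs n \<Otimes>\<^sub>M Zdist). pi_hat n \<epsilon> (fst xz) (snd xz) \<in>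
      {p. \<theta> \<le> fima_quantile n \<epsilon> \<delta> Zdist Ddist \<alpha> p}} = covered n \<delta>"
    by (auto simp: covered_def data_noise_def)
  finally show ?thesis by (simp add: data_noise_def)
qed

text \<open>\<open>B\<close> contains the product of the strip \<open>l < N \<le> r\<close> with the
  bounded noise event. It is applied to the coverage event for the lower bound and to its complement
  for the upper bound.\<close>

lemma data_rect_prob:
  assumes z: "1 - \<eta> \<le> measure Zdist {z. \<bar>z\<bar> \<le> \<epsilon> * M}" and B: "B \<in> sets (data_noise n \<theta> Zdist)"
    and sub: "\<And>x z. \<lbrakk>x \<in> space (Xs n); l < real (card {i \<in> {..<n}. x i \<in> {True}});
      real (card {i \<in> {..<n}. x i \<in> {True}}) \<le> r; \<bar>z\<bar> \<le> \<epsilon> * M\<rbrakk> \<Longrightarrow> (x, z) \<in> B"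
  shows "count_cdf n bern {True} r - count_cdf n bern {True} l - \<eta> \<le> measure (data_noise n \<theta> Zdist) B"
proof -
  interpret Z: prob_space Zdist by (rule Z)
  interpret X: prob_space "Xs n" by (intro prob_space_PiM prob_space_measure_pmf)
  interpret D: prob_space "data_noise n \<theta> Zdist" by (rule prob_data)
  let ?N = "\<lambda>x. real (card {i \<in> {..<n}. x i \<in> {True}})"
  let ?A = "\<lambda>c. {x \<in> space (Xs n). ?N x \<le> c}"
  let ?S = "{z. \<bar>z\<bar> \<le> \<epsilon> * M}"
  have [measurable]: "{True} \<in> sets bern" by simp
  have [measurable]: "?A c \<in> sets (Xs n)" for c by measurable
  have S: "?S \<in> sets Zdist" unfolding Z by measurable
  have "measure (Xs n) (?A r) \<le> measure (Xs n) ((?A r - ?A l) \<union> ?A l)"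
    by (intro X.finite_measure_mono) auto
  also have "\<dots> \<le> measure (Xs n) (?A r - ?A l) + measure (Xs n) (?A l)"
    by (intro measure_Un_le) auto
  finally have "count_cdf n bern {True} r - count_cdf n bern {True} l - \<eta>
      \<le> measure (Xs n) (?A r - ?A l) - \<eta>"
    by (simp add: count_cdf_def)
  also have "\<dots> \<le> measure Zdist ?S * measure (Xs n) (?A r - ?A l)"
    using mult_ge_diff[OF z] by simp
  also have "\<dots> = measure (data_noise n \<theta> Zdist) ((?A r - ?A l) \<times> ?S)"
    unfolding data_noise_def using S
    by (subst measure_Times) (auto simp: Z.sigma_finite_measure_axioms)
  also have "\<dots> \<le> measure (data_noise n \<theta> Zdist) B"
  proof (intro D.finite_measure_mono B subsetI)
    fix w assume "w \<in> (?A r - ?A l) \<times> ?S"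
    then show "w \<in> B" using sub[of "fst w" "snd w"] by (cases w) (simp add: not_le)
  qed
  finally show ?thesis .
qed

lemma scaled_pi_hat:
  assumes "0 < n" "\<bar>z\<bar> \<le> \<epsilon> * M"
  shows "\<bar>real n * pi_hat n \<epsilon> x z - real (card {i \<in> {..<n}. x i \<in> {True}})\<bar> \<le> M"
proof -
  have *: "real n * pi_hat n \<epsilon> x z - real (card {i \<in> {..<n}. x i \<in> {True}}) = z / \<epsilon>"
    using assms(1) by (simp add: pi_hat_def sample_prop_def field_simps)
  show ?thesis unfolding * using assms(2) \<epsilon> by (simp add: abs_divide field_simps)
qed

text \<open>A uniform falls below \<theta> with probability \<theta>, so simulated and observed
  counts are both binomial with the same parameters. This common limit calibrates the coverage to
  \<alpha>.\<close>

lemma count_cdf_lim: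
  defines "pt \<equiv> \<lambda>n c. real n * \<theta> + c * sqrt (real n * (\<theta> * (1 - \<theta>)))"
  shows "(\<lambda>n. count_cdf n unif {..<\<theta>} (pt n c)) \<longlonglongrightarrow> cdf std_normal_distribution c"
    and "(\<lambda>n. count_cdf n bern {True} (pt n c)) \<longlonglongrightarrow> cdf std_normal_distribution c"
proof -
  show "(\<lambda>n. count_cdf n unif {..<\<theta>} (pt n c)) \<longlonglongrightarrow> cdf std_normal_distribution c"
    unfolding count_cdf_def pt_def
    by (rule binomial_clt[OF prob_space_unif _ measure_unif_lessThan[OF \<theta>] \<theta>]) simp
  have "measure bern {True} = \<theta>" using \<theta> by (simp add: measure_pmf_single)
  then show "(\<lambda>n. count_cdf n bern {True} (pt n c)) \<longlonglongrightarrow> cdf std_normal_distribution c"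
    unfolding count_cdf_def pt_def
    by (intro binomial_clt prob_space_measure_pmf \<theta>) simp_all
qed

text \<open>The shifts \<open>M\<close> coming from the two noise terms are absorbed by perturbing the normal quantile
  \<open>c\<close> to \<open>c'\<close>; the cut at \<open>k\<close> keeps the count away from one end of \<open>[0, n]\<close>, the other end being
  excluded by \<open>c'\<close>.\<close>

lemma coverage_bounds:
  assumes \<eta>: "0 < \<eta>" "3 * \<eta> < \<alpha>" "3 * \<eta> < 1 - \<alpha>"
  shows "\<forall>\<^sub>F n in sequentially. \<alpha> - 7 * \<eta> \<le> measure (data_noise n \<theta> Zdist) (covered n \<delta>)"
    and "\<forall>\<^sub>F n in sequentially. measure (data_noise n \<theta> Zdist) (covered n \<delta>) \<le> \<alpha> + 7 * \<eta>"
proof -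
  let ?\<Phi> = "cdf std_normal_distribution"
  interpret \<Phi>: real_distribution std_normal_distribution by (rule real_dist_normal_dist)
  define pt where "pt n c = real n * \<theta> + c * sqrt (real n * (\<theta> * (1 - \<theta>)))" for n c
  let ?H = "\<lambda>n c. count_cdf n unif {..<\<theta>} c"
  let ?K = "\<lambda>n c. count_cdf n bern {True} c"
  have lim: "(\<lambda>n. ?H n (pt n c)) \<longlonglongrightarrow> ?\<Phi> c" "(\<lambda>n. ?K n (pt n c)) \<longlonglongrightarrow> ?\<Phi> c" for c
    unfolding pt_def by (rule count_cdf_lim)+
  have v: "0 < \<theta> * (1 - \<theta>)" using \<theta> by simp
  have less: "c < c'" if "?\<Phi> c < ?\<Phi> c'" for c c'
    using that \<Phi>.cdf_nondecreasing[of c' c] by linarith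
  obtain M where M: "0 \<le> M" and z: "1 - \<eta> \<le> measure Zdist {z. \<bar>z\<bar> \<le> \<epsilon> * M}"
    using noise_tight \<eta>(1) by blast
  have H_mono: "?H n x \<le> ?H n y" if "x \<le> y" for n x y
    using that by (intro count_cdf_mono prob_space_unif) auto
  have scale: "\<forall>\<^sub>F n in sequentially. pt n c + C \<le> pt n c'" if "c < c'" for c c' C
    using eventually_scale(1)[OF v that, of C] by eventually_elim (simp add: pt_def)
  have low: "\<forall>\<^sub>F n in sequentially. C < pt n c" for c C
    unfolding pt_def by (rule eventually_scale(2)[OF v \<theta>(1)])
  have high: "\<forall>\<^sub>F n in sequentially. pt n c + C < real n" for c C
    unfolding pt_def by (rule eventually_scale(3)[OF v \<theta>(2)])

  show "\<forall>\<^sub>F n in sequentially. \<alpha> - 7 * \<eta> \<le> measure (data_noise n \<theta> Zdist) (covered n \<delta>)"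
  proof -
    \<comment> \<open>The level at \<open>c\<close> exceeds \<open>1 - \<alpha>\<close> by one
      \<eta> for the noise and one for convergence; \<open>c'\<close> lies one \<eta> higher to
      leave room for shifts. With a further \<eta> for convergence at each of \<open>c'\<close> and
      \<open>k\<close>, the bound is
      \<open>(1 - 2 * \<eta>) - (1 - \<alpha> + 4 * \<eta>) - \<eta>\<close>, that is
      \<open>\<alpha> - 7 * \<eta>\<close>.\<close>
    obtain c where c: "?\<Phi> c = 1 - \<alpha> + 2 * \<eta>"
      by (rule std_normal_cdf_surj[of "1 - \<alpha> + 2 * \<eta>"]) (use \<eta> \<alpha> in auto)
    obtain c' where c': "?\<Phi> c' = 1 - \<alpha> + 3 * \<eta>"
      by (rule std_normal_cdf_surj[of "1 - \<alpha> + 3 * \<eta>"]) (use \<eta> \<alpha> in auto)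
    obtain k where k: "?\<Phi> k = 1 - \<eta>"
      by (rule std_normal_cdf_surj[of "1 - \<eta>"]) (use \<eta> \<alpha> in auto)
    have "\<forall>\<^sub>F n in sequentially. 1 - \<alpha> + \<eta> < ?H n (pt n c)"
      using \<eta> c by (intro order_tendstoD(1)[OF lim(1)]) auto
    moreover have "\<forall>\<^sub>F n in sequentially. ?K n (pt n c') < 1 - \<alpha> + 4 * \<eta>"
      using \<eta> c' by (intro order_tendstoD(2)[OF lim(2)]) auto
    moreover have "\<forall>\<^sub>F n in sequentially. 1 - 2 * \<eta> < ?K n (pt n k)"
      using \<eta> k by (intro order_tendstoD(1)[OF lim(2)]) auto
    \<comment> \<open>One \<open>M\<close> is the data noise in \<open>n * pi_hat\<close>; the other
      \<open>M + 2\<close> is the shift in \<open>fima_quantile_cases\<close>.\<close>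
    moreover have "\<forall>\<^sub>F n in sequentially. pt n c + (2 * M + 2) \<le> pt n c'"
      by (rule scale[OF less]) (use c c' \<eta> in auto)
    moreover note low[of "2 * M + 1" c'] high[of k "2 * M"] eventually_gt_at_top[of "0::nat"]
    ultimately show ?thesis
    proof eventually_elim
      case (elim n)
      have "(x, z) \<in> covered n \<delta>"
        if x: "x \<in> space (Xs n)" "pt n c' < real (card {i \<in> {..<n}. x i \<in> {True}})"
          "real (card {i \<in> {..<n}. x i \<in> {True}}) \<le> pt n k" "\<bar>z\<bar> \<le> \<epsilon> * M" for x z
      proof -
        define p where "p = real n * pi_hat n \<epsilon> x z"
        have p: "\<bar>p - real (card {i \<in> {..<n}. x i \<in> {True}})\<bar> \<le> M"
          unfolding p_def by (rule scaled_pi_hat) (use elim x in auto)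
        have edge: "1 \<le> p - M" "p + M < real n" and "pt n c \<le> p - M - 2"
          using p x elim by linarith+
        then have "1 - \<alpha> + \<eta> < ?H n (p - M - 2)"
          using H_mono[of "pt n c" "p - M - 2" n] elim(1) by linarith
        with edge have "\<theta> \<le> fima_quantile n \<epsilon> \<delta> Zdist Ddist \<alpha> (pi_hat n \<epsilon> x z)"
          unfolding p_def by (intro fima_quantile_cases(1)[OF z])
        then show ?thesis using x sets_eq_imp_space_eq[OF Z(2)]
          by (simp add: covered_def data_noise_def space_pair_measure)
      qed
      from data_rect_prob[OF z sets_covered this]
      have "?K n (pt n k) - ?K n (pt n c') - \<eta> \<le> measure (data_noise n \<theta> Zdist) (covered n \<delta>)" .
      with elim show ?case by linarith
    qed
  qed

  show "\<forall>\<^sub>F n in sequentially. measure (data_noise n \<theta> Zdist) (covered n \<delta>) \<le> \<alpha> + 7 * \<eta>"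
  proof -
    obtain c where c: "?\<Phi> c = 1 - \<alpha> - 2 * \<eta>"
      by (rule std_normal_cdf_surj[of "1 - \<alpha> - 2 * \<eta>"]) (use \<eta> \<alpha> in auto)
    obtain c' where c': "?\<Phi> c' = 1 - \<alpha> - 3 * \<eta>"
      by (rule std_normal_cdf_surj[of "1 - \<alpha> - 3 * \<eta>"]) (use \<eta> \<alpha> in auto)
    \<comment> \<open>Mirrored choice: the strip now lies below the quantile, so \<open>k\<close>
      cuts off the left tail, where the lower edge condition could fail.\<close>
    obtain k where k: "?\<Phi> k = \<eta>"
      by (rule std_normal_cdf_surj[of "\<eta>"]) (use \<eta> \<alpha> in auto)
    have "\<forall>\<^sub>F n in sequentially. ?H n (pt n c) < 1 - \<alpha> - \<eta>"
      using \<eta> c by (intro order_tendstoD(2)[OF lim(1)]) auto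
    moreover have "\<forall>\<^sub>F n in sequentially. 1 - \<alpha> - 4 * \<eta> < ?K n (pt n c')"
      using \<eta> c' by (intro order_tendstoD(1)[OF lim(2)]) auto
    moreover have "\<forall>\<^sub>F n in sequentially. ?K n (pt n k) < 2 * \<eta>"
      using \<eta> k by (intro order_tendstoD(2)[OF lim(2)]) auto
    moreover have "\<forall>\<^sub>F n in sequentially. pt n c' + (2 * M + 1) \<le> pt n c"
      by (rule scale[OF less]) (use c c' \<eta> in auto)
    moreover note low[of "2 * M + 1" k] high[of c' "2 * M"] eventually_gt_at_top[of "0::nat"]
    ultimately show ?thesis
    proof eventually_elim
      case (elim n)
      interpret D: prob_space "data_noise n \<theta> Zdist" by (rule prob_data)
      have "(x, z) \<in> space (data_noise n \<theta> Zdist) - covered n \<delta>"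
        if x: "x \<in> space (Xs n)" "pt n k < real (card {i \<in> {..<n}. x i \<in> {True}})"
          "real (card {i \<in> {..<n}. x i \<in> {True}}) \<le> pt n c'" "\<bar>z\<bar> \<le> \<epsilon> * M" for x z
      proof -
        define p where "p = real n * pi_hat n \<epsilon> x z"
        have p: "\<bar>p - real (card {i \<in> {..<n}. x i \<in> {True}})\<bar> \<le> M"
          unfolding p_def by (rule scaled_pi_hat) (use elim x in auto)
        have edge: "1 \<le> p - M" "p + M < real n" and "p + M + 1 \<le> pt n c"
          using p x elim by linarith+
        then have "?H n (p + M + 1) < 1 - \<alpha> - \<eta>"
          using H_mono[of "p + M + 1" "pt n c" n] elim(1) by linarith
        with edge have "\<not> \<theta> \<le> fima_quantile n \<epsilon> \<delta> Zdist Ddist \<alpha> (pi_hat n \<epsilon> x z)"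
          unfolding p_def by (intro fima_quantile_cases(2)[OF z])
        then show ?thesis using x sets_eq_imp_space_eq[OF Z(2)]
          by (simp add: covered_def data_noise_def space_pair_measure)
      qed
      \<comment> \<open>The upper bound on coverage is the lower bound
        \<open>1 - \<alpha> - 7 * \<eta>\<close> on the probability of the complement.\<close>
      from data_rect_prob[OF z sets.compl_sets[OF sets_covered] this]
      have "?K n (pt n c') - ?K n (pt n k) - \<eta>
          \<le> measure (data_noise n \<theta> Zdist) (space (data_noise n \<theta> Zdist) - covered n \<delta>)" .
      also have "\<dots> = 1 - measure (data_noise n \<theta> Zdist) (covered n \<delta>)"
        by (rule D.prob_compl[OF sets_covered])
      finally show ?case using elim by linarith
    qed
  qed
qed

lemma coverage_tendsto: "(\<lambda>n. measure (data_noise n \<theta> Zdist) (covered n \<delta>)) \<longlonglongrightarrow> \<alpha>"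
proof (rule tendstoI)
  fix e :: real assume "0 < e"
  \<comment> \<open>The divisor 8 yields \<open>7 * \<eta> < e\<close>; the divisors 4 yield the two
    constraints on \<open>3 * \<eta>\<close>.\<close>
  define \<eta> where "\<eta> = min (e / 8) (min (\<alpha> / 4) ((1 - \<alpha>) / 4))"
  have \<eta>: "0 < \<eta>" "3 * \<eta> < \<alpha>" "3 * \<eta> < 1 - \<alpha>" "7 * \<eta> < e"
    using \<open>0 < e\<close> \<alpha> by (auto simp: \<eta>_def min_def)
  show "\<forall>\<^sub>F n in sequentially. dist (measure (data_noise n \<theta> Zdist) (covered n \<delta>)) \<alpha> < e"
    using coverage_bounds[OF \<eta>(1-3), of \<delta>] by eventually_elim (use \<eta>(4) in \<open>auto simp: dist_real_def\<close>)
qed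

end

theorem theorem1:
  fixes \<theta>0 \<epsilon> \<delta> \<alpha> :: real and Zdist Ddist :: "real measure"
  assumes "0 < \<theta>0" "\<theta>0 < 1"
    and "0 < \<epsilon>"
    and "0 < \<delta>" "\<delta> < 1/2"
    and "0 < \<alpha>" "\<alpha> < 1"
    and "prob_space Zdist" "sets Zdist = sets borel"
    and "integrable Zdist (\<lambda>z. z ^ 2)"
    and "(\<integral>z. z \<partial>Zdist) = 0"
    and "(\<integral>z. z ^ 2 \<partial>Zdist) = 1"
    and "prob_space Ddist" "sets Ddist = sets borel"
    and "emeasure Ddist {0..1} = 1"
  shows "(\<lambda>n. measure (data_noise n \<theta>0 Zdist)
            {(x, z) \<in> space (data_noise n \<theta>0 Zdist).
               \<theta>0 \<le> fima_quantile n \<epsilon> \<delta> Zdist Ddist \<alpha> (pi_hat n \<epsilon> x z)})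
         \<longlonglongrightarrow> \<alpha>"
proof -
  interpret fima \<theta>0 \<epsilon> \<alpha> Zdist Ddist
    by (rule fima.intro) fact+
  show ?thesis
    using coverage_tendsto[of \<delta>] unfolding covered_def .
qed

end
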